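(* Let $S=\{1,\dots,n\}$, let $S_\ell,S_{\ell'}$ be subsets of $S$, and let $sim$ denote the similarity of $S_\ell$ and $S_{\ell'}$. Let $I_1=S_\ell\setminus S_{\ell'}$, $I_2=S_\ell\cap S_{\ell'}$, $I_3=S_{\ell'}\setminus S_\ell$. Let $Z_1,\dots,Z_k$ be independent random permutations of $S$, each picked uniformly from the set of all permutations of $S$. For $1\le\alpha\le k$ put $U_\ell(\alpha)=\min_{i\in S_\ell}Z_\alpha(i)$ and $U_{\ell'}(\alpha)=\min_{i\in S_{\ell'}}Z_\alpha(i)$; let $S(\alpha)=1$ if $U_\ell(\alpha)=U_{\ell'}(\alpha)$ and $S(\alpha)=0$ otherwise; and let $simrum=\frac1k\sum_{\alpha=1}^kS(\alpha)$. Then, for each $\alpha$, the event $U_\ell(\alpha)=U_{\ell'}(\alpha)$ is equivalent to $\min_{i\in I_2}Z_\alpha(i)<\min_{i\in I_1\cup I_3}Z_\alpha(i)$ and has probability $\#(S_\ell\cap S_{\ell'})/n$. The variables $S(1),\dots,S(k)$ are independent Bernoulli random variables with parameter $sim=\#(I_2)/n$, and $S_k=\sum_{1\le\alpha\le k}S(\alpha)$ equals $k$ times $simrum$. Consequently: (1) Moments: $\mathbb E(simrum)=sim$ and $\mathbb{V}ar(simrum)=sim(1-sim)/k$. (2) Tchebychev inequality: $\mathbb P(|simrum-sim|>\lambda)\le \dfrac{sim(1-sim)}{k\lambda^2}$ for $\lambda>0$. (3) Gaussian approximation: if the similarity $sim$ is non-zero, then $$\sqrt{\frac{k}{sim(1-sim)}}\,\bigl(simrum-sim\bigr)\rightarrow\mathcal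 N(0,1),$$ which gives the approximated 95% confidence interval $$sim\in\left[simrum-1.96\,\frac{\sqrt{simrum(1-simrum)}}{k},\ simrum+1.96\,\frac{\sqrt{simrum(1-simrum)}}{k}\right].$$
   Context: $\#A$ denotes the cardinality of a finite set $A$. The (Jaccard) similarity of two sets $A,B$ is $\#(A\cap B)/\#(A\cup B)$. $\mathcal N(0,1)$ is the standard normal law. The quantity $simrum$ is the similarity estimated by the minhashing method with $k$ minhashing functions, here taken to be independent uniform random permutations $Z_1,\dots,Z_k$ of $S$, with the elements of $S$ kept in a fixed order.
   Formalization: The formulas with #(I_2)/n are stated only when the two sets cover S (otherwise the parameter is sim, the Jaccard similarity); the union is nonempty; (3) also requires sim ≠ 1; the interval has half-width 1.96·sqrt(simrum(1−simrum))/sqrt(k), not /k. *)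

theory Defs
  imports "HOL-Probability.Probability"
begin

definition similarity :: "'a set \<Rightarrow> 'a set \<Rightarrow> real" where
  "similarity A B = real (card (A \<inter> B)) / real (card (A \<union> B))"

(* Values in enat, so that the minimum over the empty set is \<infinity>: neither set, nor any of
   A - B, A \<inter> B, B - A, has to be nonempty for the minima below to be meaningful. *)
definition min_over :: "('a \<Rightarrow> nat) \<Rightarrow> 'a set \<Rightarrow> enat" where
  "min_over z A = (INF i\<in>A. enat (z i))"

definition perms :: "nat \<Rightarrow> (nat \<Rightarrow> nat) set" where
  "perms n = {p. p permutes {1..n}}"

definition iid_uniform_perms ::
    "nat \<Rightarrow> nat \<Rightarrow> 'w measure \<Rightarrow> (nat \<Rightarrow> 'w \<Rightarrow> nat \<Rightarrow> nat) \<Rightarrow> bool" where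
  "iid_uniform_perms n k M Z \<longleftrightarrow>
     prob_space M \<and>
     prob_space.indep_vars M (\<lambda>_. count_space (perms n)) Z {1..k} \<and>
     (\<forall>\<alpha>\<in>{1..k}. distr M (count_space (perms n)) (Z \<alpha>) = uniform_count_measure (perms n))"

definition agree :: "(nat \<Rightarrow> 'w \<Rightarrow> nat \<Rightarrow> nat) \<Rightarrow> nat set \<Rightarrow> nat set \<Rightarrow> nat \<Rightarrow> 'w \<Rightarrow> real" where
  "agree Z A B \<alpha> \<omega> = (if min_over (Z \<alpha> \<omega>) A = min_over (Z \<alpha> \<omega>) B then 1 else 0)"

definition simrum :: "nat \<Rightarrow> (nat \<Rightarrow> 'w \<Rightarrow> nat \<Rightarrow> nat) \<Rightarrow> nat set \<Rightarrow> nat set \<Rightarrow> 'w \<Rightarrow> real" where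
  "simrum k Z A B \<omega> = (1 / real k) * (\<Sum>\<alpha>=1..k. agree Z A B \<alpha> \<omega>)"

(* The half-width is the one given by the Gaussian approximation, with sqrt k and not k
   in the denominator. *)
definition ci95 :: "nat \<Rightarrow> real \<Rightarrow> real set" where
  "ci95 k x = {x - 1.96 * sqrt (x * (1 - x)) / sqrt (real k) ..
               x + 1.96 * sqrt (x * (1 - x)) / sqrt (real k)}"

end

(* The minima of an injective map over A and B agree exactly when its minimum over A Un B is
   attained in A Int B; by symmetry under transpositions that minimum is attained equally often at
   each point of A Un B, so agreement has probability similarity A B.

   For the confidence interval, sim lies in ci95 iff m (x - sim)^2 <= 1.96^2 x (1 - x) with
   x = simrum. For every e > 0 and all large m this condition is implied by |T| <= 1.96 - e and
   implies |T| < 1.96 + e, where T is the standardised estimate, uniformly in x. So continuity of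
   the normal distribution function replaces an appeal to Slutsky's theorem. *)

theory Submission
  imports Defs
begin

section \<open>Minima and random permutations\<close>

text \<open>Estimates for different numbers of permutations need not live on one probability space,
  so a central limit theorem for a single sequence does not apply directly. Weak convergence and
  coverage probabilities depend only on the individual laws, and the law of an i.i.d. sum is fixed
  by the law of one summand and the number of summands. Each row is therefore exchanged for a block
  of coordinates of one infinite product measure.

  The nominal level 0.95 is itself a rounded number: the normal mass of [-1.96, 1.96] is about
  0.950004. The limit of the coverage is therefore stated as that exact mass, and a separate
  numerical bound places it within 1/10000 of 0.95.\<close>

lemma min_over_le: "i \<in> A \<Longrightarrow> min_over z A \<le> enat (z i)"
  unfolding min_over_def by (rule INF_lower)

text \<open>Infima in \<open>enat\<close> are given by LEAST, so well-ordering makes the infimum of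
  a nonempty set one of its members.\<close>

lemma min_over_attained:
  assumes "A \<noteq> {}"
  obtains i where "i \<in> A" "min_over z A = enat (z i)"
proof -
  have "Inf ((\<lambda>i. enat (z i)) ` A) \<in> (\<lambda>i. enat (z i)) ` A"
    using assms unfolding Inf_enat_def by (auto intro: LeastI)
  with that show ?thesis unfolding min_over_def by blast
qed

lemma min_over_empty [simp]: "min_over z {} = \<infinity>"
  by (simp add: min_over_def Inf_enat_def)

lemma min_over_eqI:
  assumes "i \<in> A" "\<And>j. j \<in> A \<Longrightarrow> z i \<le> z j"
  shows "min_over z A = enat (z i)"
  using assms by (intro antisym min_over_le) (auto simp: min_over_def intro: INF_greatest)

text \<open>Equal finite minima are attained at some i in A and some j in B with the same value;
  injectivity merges the two points into one of the intersection. For A = B = {} both minima are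
  \<infinity> and agree although no minimiser exists, which \<open>ne\<close> excludes.\<close>

lemma min_over_eq_iff_argmin:
  assumes inj: "inj_on z (A \<union> B)" and ne: "A \<union> B \<noteq> {}"
  shows "min_over z A = min_over z B \<longleftrightarrow> (\<exists>i\<in>A \<inter> B. \<forall>j\<in>A \<union> B. z i \<le> z j)"
proof
  assume eq: "min_over z A = min_over z B"
  have fin: "min_over z C \<noteq> \<infinity>" if "C \<noteq> {}" for C
    using min_over_attained[OF that, of z] by (metis enat.distinct(1))
  have "A = {} \<longleftrightarrow> B = {}"
    using fin[of A] fin[of B] eq by fastforce
  then have "A \<noteq> {}" "B \<noteq> {}" using ne by auto
  obtain i where i: "i \<in> A" "min_over z A = enat (z i)"
    using min_over_attained[OF \<open>A \<noteq> {}\<close>] .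
  obtain j where j: "j \<in> B" "min_over z B = enat (z j)"
    using min_over_attained[OF \<open>B \<noteq> {}\<close>] .
  have "i = j" using eq i j inj by (auto dest: inj_onD)
  moreover have "z i \<le> z l" if "l \<in> A \<union> B" for l
  proof -
    have "min_over z A \<le> enat (z l)"
      using that eq min_over_le[of l A z] min_over_le[of l B z] by auto
    then show ?thesis using i by simp
  qed
  ultimately show "\<exists>i\<in>A \<inter> B. \<forall>j\<in>A \<union> B. z i \<le> z j" using i j by blast
next
  assume "\<exists>i\<in>A \<inter> B. \<forall>j\<in>A \<union> B. z i \<le> z j"
  then obtain i where "i \<in> A \<inter> B" "\<forall>j\<in>A \<union> B. z i \<le> z j" by blast
  then show "min_over z A = min_over z B"
    using min_over_eqI[of i A z] min_over_eqI[of i B z] by auto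
qed

text \<open>The right-hand side is that of \<open>min_over_eq_iff_argmin\<close>, so the two chain
  into the equivalence of agreement with a strict inequality. Strictness comes from injectivity: the
  minimisers over the intersection and over the symmetric difference are distinct points.\<close>

lemma min_over_Int_less_iff_argmin:
  assumes inj: "inj_on z (A \<union> B)"
  shows "min_over z (A \<inter> B) < min_over z ((A - B) \<union> (B - A))
     \<longleftrightarrow> (\<exists>i\<in>A \<inter> B. \<forall>j\<in>A \<union> B. z i \<le> z j)"
proof
  assume less: "min_over z (A \<inter> B) < min_over z ((A - B) \<union> (B - A))"
  then have "A \<inter> B \<noteq> {}" by auto
  then obtain i where i: "i \<in> A \<inter> B" "min_over z (A \<inter> B) = enat (z i)"
    by (rule min_over_attained)
  have "z i \<le> z j" if "j \<in> A \<union> B" for j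
  proof (cases "j \<in> A \<inter> B")
    case True
    then show ?thesis using min_over_le[of j "A \<inter> B" z] i by simp
  next
    case False
    then have "min_over z ((A - B) \<union> (B - A)) \<le> enat (z j)" using that by (intro min_over_le) auto
    with less i have "enat (z i) < enat (z j)" by (metis less_le_trans)
    then show ?thesis by simp
  qed
  then show "\<exists>i\<in>A \<inter> B. \<forall>j\<in>A \<union> B. z i \<le> z j" using i by blast
next
  assume "\<exists>i\<in>A \<inter> B. \<forall>j\<in>A \<union> B. z i \<le> z j"
  then obtain i where i: "i \<in> A \<inter> B" "\<forall>j\<in>A \<union> B. z i \<le> z j" by blast
  then have eq: "min_over z (A \<inter> B) = enat (z i)" by (intro min_over_eqI) auto
  show "min_over z (A \<inter> B) < min_over z ((A - B) \<union> (B - A))"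
  proof (cases "(A - B) \<union> (B - A) = {}")
    \<comment> \<open>Here A = B, and the right-hand minimum is \<infinity>.\<close>
    case True
    then show ?thesis using eq by (simp only: min_over_empty) simp
  next
    case False
    then obtain j where j: "j \<in> (A - B) \<union> (B - A)" "min_over z ((A - B) \<union> (B - A)) = enat (z j)"
      by (rule min_over_attained)
    then have "z i \<le> z j" "i \<noteq> j" using i by auto
    moreover have "z i \<noteq> z j" using inj i j \<open>i \<noteq> j\<close> by (auto dest: inj_onD)
    ultimately show ?thesis unfolding eq j(2) by simp
  qed
qed

section \<open>Counting permutations by the place of their minimum over a set\<close>

lemma finite_perms: "finite (perms n)"
  unfolding perms_def by (simp add: finite_permutations)

lemma card_perms: "card (perms n) = fact n"
  unfolding perms_def by (simp add: card_permutations)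

text \<open>Precomposition with the transposition of i and j is an involution of
  \<open>perms n\<close>. It exchanges the two sets because the transposition maps C to itself and
  swaps the two candidate places.\<close>

lemma card_perms_argmin_eq:
  assumes C: "C \<subseteq> {1..n}" and ij: "i \<in> C" "j \<in> C"
  shows "card {p \<in> perms n. \<forall>l\<in>C. p i \<le> p l} = card {p \<in> perms n. \<forall>l\<in>C. p j \<le> p l}"
proof (rule bij_betw_same_card)
  let ?t = "Transposition.transpose i j"
  have t: "?t permutes {1..n}" using C ij by (intro permutes_swap_id) auto
  have tC: "?t l \<in> C" if "l \<in> C" for l using that ij by (auto simp: Transposition.transpose_def)
  show "bij_betw (\<lambda>p. p \<circ> ?t) {p \<in> perms n. \<forall>l\<in>C. p i \<le> p l} {p \<in> perms n. \<forall>l\<in>C. p j \<le> p l}"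
    by (rule bij_betw_byWitness[where f' = "\<lambda>p. p \<circ> ?t"])
      (auto simp: perms_def comp_assoc tC intro!: permutes_compose[OF t[simplified]])
qed

lemma perms_argmin_unique:
  assumes "p \<in> perms n" "j \<in> C" "l \<in> C" "\<forall>m\<in>C. p j \<le> p m" "\<forall>m\<in>C. p l \<le> p m"
  shows "j = l"
proof -
  have "p j \<le> p l" "p l \<le> p j" using assms by blast+
  then have "p j = p l" by simp
  moreover have "inj p" using assms(1) by (auto simp: perms_def dest: permutes_inj)
  ultimately show ?thesis by (auto dest: injD)
qed

lemma card_perms_argmin_in_eq_sum:
  assumes "finite C" "D \<subseteq> C"
  shows "card {p \<in> perms n. \<exists>i\<in>D. \<forall>l\<in>C. p i \<le> p l}
    = (\<Sum>i\<in>D. card {p \<in> perms n. \<forall>l\<in>C. p i \<le> p l})"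
proof -
  let ?P = "\<lambda>i. {p \<in> perms n. \<forall>l\<in>C. p i \<le> p l}"
  have disj: "\<forall>i\<in>D. \<forall>j\<in>D. i \<noteq> j \<longrightarrow> ?P i \<inter> ?P j = {}"
    using perms_argmin_unique[of _ n _ C] assms(2) by blast
  have fin: "\<forall>i\<in>D. finite (?P i)" using finite_perms by simp
  have "{p \<in> perms n. \<exists>i\<in>D. \<forall>l\<in>C. p i \<le> p l} = (\<Union>i\<in>D. ?P i)" by blast
  then show ?thesis
    using card_UN_disjoint[OF finite_subset[OF assms(2,1)] fin disj] by (simp only:)
qed

text \<open>Every permutation has a minimiser over C, so the equally large classes of the points of
  C exhaust all n! permutations.\<close>

lemma card_perms_argmin:
  assumes C: "C \<subseteq> {1..n}" and i: "i \<in> C"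
  shows "card C * card {p \<in> perms n. \<forall>l\<in>C. p i \<le> p l} = fact n"
proof -
  have fin: "finite C" using C finite_subset by blast
  have "\<exists>j\<in>C. \<forall>l\<in>C. p j \<le> p l" for p :: "nat \<Rightarrow> nat"
  proof -
    have "Min (p ` C) \<in> p ` C" using fin i by (intro Min_in) auto
    then obtain j where "j \<in> C" "p j = Min (p ` C)" by force
    moreover have "\<forall>l\<in>C. Min (p ` C) \<le> p l" using fin by simp
    ultimately show ?thesis by metis
  qed
  then have "perms n = {p \<in> perms n. \<exists>j\<in>C. \<forall>l\<in>C. p j \<le> p l}" by blast
  then have "fact n = card {p \<in> perms n. \<exists>j\<in>C. \<forall>l\<in>C. p j \<le> p l}"
    by (metis card_perms)
  also have "\<dots> = (\<Sum>j\<in>C. card {p \<in> perms n. \<forall>l\<in>C. p j \<le> p l})"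
    by (rule card_perms_argmin_in_eq_sum[OF fin order_refl])
  also have "\<dots> = (\<Sum>j\<in>C. card {p \<in> perms n. \<forall>l\<in>C. p i \<le> p l})"
    by (intro sum.cong refl card_perms_argmin_eq[OF C _ i])
  finally show ?thesis by simp
qed

text \<open>Cross-multiplied, so that the count stays in \<open>nat\<close>; it is used with C the
  union and D the intersection of the two sets.\<close>

lemma card_perms_argmin_in:
  assumes C: "C \<subseteq> {1..n}" and D: "D \<subseteq> C"
  shows "card C * card {p \<in> perms n. \<exists>i\<in>D. \<forall>l\<in>C. p i \<le> p l} = card D * fact n"
proof -
  have "finite C" using C finite_subset by blast
  then have "card C * card {p \<in> perms n. \<exists>i\<in>D. \<forall>l\<in>C. p i \<le> p l}
      = (\<Sum>i\<in>D. card C * card {p \<in> perms n. \<forall>l\<in>C. p i \<le> p l})"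
    by (simp only: card_perms_argmin_in_eq_sum[OF _ D] sum_distrib_left)
  also have "\<dots> = (\<Sum>i\<in>D. fact n)"
    using D by (intro sum.cong refl card_perms_argmin[OF C]) blast
  finally show ?thesis by simp
qed

section \<open>The standard normal law of [-1.96, 1.96]\<close>

text \<open>The sign of the Lagrange remainder decides: an even power of -y is nonnegative. With y =
  x^2/2, partial sums with even and odd numbers of terms bracket the Gaussian integrand.\<close>

lemma exp_minus_le_even_Taylor:
  fixes y :: real
  assumes "even n"
  shows "(\<Sum>k<n. (- y) ^ k / fact k) \<le> exp (- y)"
proof -
  obtain t where "exp (- y) = (\<Sum>k<n. (- y) ^ k / fact k) + exp t / fact n * (- y) ^ n"
    using Maclaurin_exp_le[of "- y" n] by blast
  moreover have "0 \<le> exp t / fact n * (- y) ^ n"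
    using assms by (simp add: zero_le_even_power)
  ultimately show ?thesis by linarith
qed

lemma exp_minus_ge_odd_Taylor:
  fixes y :: real
  assumes "odd n" "0 \<le> y"
  shows "exp (- y) \<le> (\<Sum>k<n. (- y) ^ k / fact k)"
proof -
  obtain t where "exp (- y) = (\<Sum>k<n. (- y) ^ k / fact k) + exp t / fact n * (- y) ^ n"
    using Maclaurin_exp_le[of "- y" n] by blast
  moreover have "exp t / fact n * (- y) ^ n \<le> 0"
    using assms by (simp add: mult_nonneg_nonpos power_minus_odd)
  ultimately show ?thesis by linarith
qed

text \<open>The bracketing partial sums are polynomials in x and integrate exactly; \<open>F\<close>
  is their termwise antiderivative, which turns the bounds into rational arithmetic.\<close>

lemma integral_exp_Taylor_half_square:
  fixes a b :: real and n :: nat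
  assumes "a \<le> b"
  defines "F \<equiv> \<lambda>x. \<Sum>k<n. (- 1 / 2) ^ k / fact k * (x ^ (2 * k + 1) / real (2 * k + 1))"
  shows "has_bochner_integral lborel (\<lambda>x. (\<Sum>k<n. (- (x\<^sup>2 / 2)) ^ k / fact k) * indicator {a..b} x) (F b - F a)"
proof (rule has_bochner_integral_FTC_Icc_real[OF assms(1)])
  have pw: "(- (x\<^sup>2 / 2)) ^ k = (- 1 / 2) ^ k * x ^ (2 * k)" for x :: real and k
    by (simp add: power_mult power_mult_distrib[symmetric])
  show "(F has_real_derivative (\<Sum>k<n. (- (x\<^sup>2 / 2)) ^ k / fact k)) (at x)" for x
    unfolding F_def
  proof (rule DERIV_sum)
    fix k
    have "((\<lambda>x. x ^ (2 * k + 1) / real (2 * k + 1)) has_real_derivative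
       real (2 * k + 1) * x ^ (2 * k) / real (2 * k + 1)) (at x)"
      by (rule DERIV_cdivide, rule DERIV_cong[OF DERIV_pow]) simp
    then have "((\<lambda>x. x ^ (2 * k + 1) / real (2 * k + 1)) has_real_derivative x ^ (2 * k)) (at x)"
      by (simp del: of_nat_Suc of_nat_add of_nat_mult)
    from DERIV_cmult[OF this, of "(- 1 / 2) ^ k / fact k"]
    show "((\<lambda>x. (- 1 / 2) ^ k / fact k * (x ^ (2 * k + 1) / real (2 * k + 1))) has_real_derivative
        (- (x\<^sup>2 / 2)) ^ k / fact k) (at x)"
      by (simp add: pw)
  qed
  show "isCont (\<lambda>x. \<Sum>k<n. (- (x\<^sup>2 / 2)) ^ k / fact k) x" for x :: real
    by (intro continuous_intros) auto
qed

lemma measure_std_normal_Icc: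
  "measure std_normal_distribution {a..b}
     = (\<integral>x. exp (- (x\<^sup>2 / 2)) * indicator {a..b} x \<partial>lborel) / sqrt (2 * pi)"
proof -
  have "measure std_normal_distribution {a..b} = (\<integral>x. indicator {a..b} x \<partial>std_normal_distribution)"
    by simp
  also have "\<dots> = (\<integral>x. std_normal_density x *\<^sub>R indicator {a..b} x \<partial>lborel)"
    by (subst integral_density) auto
  also have "\<dots> = (\<integral>x. exp (- (x\<^sup>2 / 2)) * indicator {a..b} x / sqrt (2 * pi) \<partial>lborel)"
    by (intro Bochner_Integration.integral_cong) (auto simp: std_normal_density_def)
  finally show ?thesis by simp
qed

lemma measure_std_normal_196:
  "\<bar>measure std_normal_distribution {-1.96..1.96} - 0.95\<bar> < 1 / 10000"
proof -
  define I where "I = (\<integral>x. exp (- (x\<^sup>2 / 2)) * indicator {-1.96..1.96::real} x \<partial>lborel)"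
  define F where "F n x = (\<Sum>k<n. (- 1 / 2) ^ k / fact k * (x ^ (2 * k + 1) / real (2 * k + 1)))"
    for n :: nat and x :: real
  have T: "has_bochner_integral lborel
      (\<lambda>x. (\<Sum>k<n. (- (x\<^sup>2 / 2)) ^ k / fact k) * indicator {-1.96..1.96::real} x) (F n 1.96 - F n (-1.96))" for n
    unfolding F_def by (rule integral_exp_Taylor_half_square) simp
  have int: "integrable lborel (\<lambda>x. exp (- (x\<^sup>2 / 2)) * indicator {-1.96..1.96::real} x)"
  proof -
    have "continuous_on {-1.96..1.96} (\<lambda>x::real. exp (- (x\<^sup>2 / 2)))"
      by (intro continuous_intros) auto
    from borel_integrable_compact[OF compact_Icc this] show ?thesis
      by (simp add: mult.commute)
  qed
  \<comment> \<open>With 10 and 11 terms the two bounds differ by 2 * 1.96^21 / (2^10 * 10! * 21) <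
    0.00004, well inside the tolerance 0.0001 * sqrt(2 pi), which is about 0.00025.\<close>
  have "F 10 1.96 - F 10 (-1.96) \<le> I"
    unfolding I_def has_bochner_integral_integral_eq[OF T, symmetric]
    by (intro integral_mono int integrable.intros[OF T] mult_right_mono
        exp_minus_le_even_Taylor) auto
  moreover have "I \<le> F 11 1.96 - F 11 (-1.96)"
    unfolding I_def has_bochner_integral_integral_eq[OF T, symmetric]
    by (intro integral_mono int integrable.intros[OF T] mult_right_mono
        exp_minus_ge_odd_Taylor) auto
  moreover have "2.3812 \<le> F 10 1.96 - F 10 (-1.96)"
    by (simp add: F_def lessThan_nat_numeral fact_numeral power_divide)
  moreover have "F 11 1.96 - F 11 (-1.96) \<le> 2.3814"
    by (simp add: F_def lessThan_nat_numeral fact_numeral power_divide)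
  ultimately have I: "2.3812 \<le> I" "I \<le> 2.3814" by linarith+
  \<comment> \<open>Four decimals suffice: 0.9499 * 2.5067 < 2.3812 and 2.3814 < 0.9501 *
    2.5066.\<close>
  have s: "2.5066 \<le> sqrt (2 * pi)" "sqrt (2 * pi) \<le> 2.5067"
    using pi_approx by (intro real_le_rsqrt real_le_lsqrt; simp add: power2_eq_square)+
  have "0.9499 * sqrt (2 * pi) < I" "I < 0.9501 * sqrt (2 * pi)"
    using I s by simp_all
  then have "9499 / 10000 < I / sqrt (2 * pi)" "I / sqrt (2 * pi) < 9501 / 10000"
    using s by (auto simp: field_simps)
  then have "\<bar>I / sqrt (2 * pi) - 95 / 100\<bar> < 1 / 10000" by linarith
  then show ?thesis
    unfolding measure_std_normal_Icc I_def[symmetric] by simp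
qed

section \<open>Sums of independent random variables\<close>

lemma (in prob_space) variance_add_indep:
  fixes X Y :: "'a \<Rightarrow> real"
  assumes ind: "indep_var borel X borel Y"
    and X2: "integrable M (\<lambda>x. (X x)\<^sup>2)" and Y2: "integrable M (\<lambda>x. (Y x)\<^sup>2)"
  shows "integrable M (\<lambda>x. (X x + Y x)\<^sup>2)"
    and "variance (\<lambda>x. X x + Y x) = variance X + variance Y"
proof -
  have [measurable]: "X \<in> borel_measurable M" "Y \<in> borel_measurable M"
    using indep_var_rv1[OF ind] indep_var_rv2[OF ind] by simp_all
  have X: "integrable M X" and Y: "integrable M Y"
    using square_integrable_imp_integrable[OF _ X2] square_integrable_imp_integrable[OF _ Y2] by simp_all
  have XY: "integrable M (\<lambda>x. X x * Y x)" "expectation (\<lambda>x. X x * Y x) = expectation X * expectation Y"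
    using indep_var_integrable[OF ind X Y] indep_var_lebesgue_integral[OF ind X Y] by simp_all
  have sq: "(X x + Y x)\<^sup>2 = (X x)\<^sup>2 + (Y x)\<^sup>2 + 2 * (X x * Y x)" for x
    by (simp add: power2_sum)
  show S2: "integrable M (\<lambda>x. (X x + Y x)\<^sup>2)"
    unfolding sq using X2 Y2 XY by simp
  have "variance (\<lambda>x. X x + Y x)
      = expectation (\<lambda>x. (X x + Y x)\<^sup>2) - (expectation X + expectation Y)\<^sup>2"
    using X Y S2 by (subst variance_eq) auto
  also have "expectation (\<lambda>x. (X x + Y x)\<^sup>2)
      = expectation (\<lambda>x. (X x)\<^sup>2) + expectation (\<lambda>x. (Y x)\<^sup>2) + 2 * (expectation X * expectation Y)"
    unfolding sq using X2 Y2 XY by simp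
  finally show "variance (\<lambda>x. X x + Y x) = variance X + variance Y"
    using X Y X2 Y2 by (simp add: variance_eq power2_sum)
qed

lemma (in prob_space) variance_sum_indep:
  fixes X :: "'i \<Rightarrow> 'a \<Rightarrow> real"
  assumes "finite I" "indep_vars (\<lambda>_. borel) X I" "\<And>i. i \<in> I \<Longrightarrow> integrable M (\<lambda>x. (X i x)\<^sup>2)"
  shows "integrable M (\<lambda>x. (\<Sum>i\<in>I. X i x)\<^sup>2)"
    and "variance (\<lambda>x. \<Sum>i\<in>I. X i x) = (\<Sum>i\<in>I. variance (X i))"
proof -
  \<comment> \<open>Both claims go through one induction, since adding a summand to the variance
    requires the partial sum to be square integrable.\<close>
  have "integrable M (\<lambda>x. (\<Sum>i\<in>I. X i x)\<^sup>2) \<and>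
      variance (\<lambda>x. \<Sum>i\<in>I. X i x) = (\<Sum>i\<in>I. variance (X i))"
    using assms
  proof (induction I rule: finite_induct)
    case (insert i I)
    have ind: "indep_vars (\<lambda>_. borel) X I"
      using insert.prems(1) by (rule indep_vars_subset) auto
    have IH: "integrable M (\<lambda>x. (\<Sum>i\<in>I. X i x)\<^sup>2)"
        "variance (\<lambda>x. \<Sum>i\<in>I. X i x) = (\<Sum>i\<in>I. variance (X i))"
      using insert.IH[OF ind] insert.prems(2) by auto
    have "indep_var borel (X i) borel (\<lambda>x. \<Sum>i\<in>I. X i x)"
      using indep_vars_sum[OF insert.hyps(1,2) insert.prems(1)] .
    from variance_add_indep[OF this insert.prems(2) IH(1)]
    show ?case using insert.hyps IH(2) by simp
  qed simp
  then show "integrable M (\<lambda>x. (\<Sum>i\<in>I. X i x)\<^sup>2)"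
    and "variance (\<lambda>x. \<Sum>i\<in>I. X i x) = (\<Sum>i\<in>I. variance (X i))" by auto
qed

section \<open>Laws of i.i.d. sums and the central limit theorem for rows\<close>

lemma (in prob_space) char_distr_sum_iid:
  fixes X :: "'i \<Rightarrow> 'a \<Rightarrow> real"
  assumes "indep_vars (\<lambda>_. borel) X I" "\<And>i. i \<in> I \<Longrightarrow> distr M borel (X i) = \<nu>"
  shows "char (distr M borel (\<lambda>\<omega>. \<Sum>i\<in>I. X i \<omega>)) = (\<lambda>t. char \<nu> t ^ card I)"
  using assms by (auto simp: char_distr_sum)

text \<open>Both characteristic functions are the same power of \<open>char \<nu>\<close>, and Levy
  uniqueness recovers the law. The two probability spaces may differ, which allows a row to be
  replaced by a model.\<close>

lemma distr_sum_iid_cong: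
  fixes X :: "'i \<Rightarrow> 'a \<Rightarrow> real" and Y :: "'j \<Rightarrow> 'b \<Rightarrow> real"
  assumes M: "prob_space M" and X: "prob_space.indep_vars M (\<lambda>_. borel) X I"
      "\<And>i. i \<in> I \<Longrightarrow> distr M borel (X i) = \<nu>"
    and N: "prob_space N" and Y: "prob_space.indep_vars N (\<lambda>_. borel) Y J"
      "\<And>j. j \<in> J \<Longrightarrow> distr N borel (Y j) = \<nu>"
    and card: "card I = card J"
  shows "distr M borel (\<lambda>\<omega>. \<Sum>i\<in>I. X i \<omega>) = distr N borel (\<lambda>\<omega>. \<Sum>j\<in>J. Y j \<omega>)"
proof -
  interpret M: prob_space M by fact
  interpret N: prob_space N by fact
  have [measurable]: "i \<in> I \<Longrightarrow> X i \<in> borel_measurable M" "j \<in> J \<Longrightarrow> Y j \<in> borel_measurable N" for i j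
    using X(1) Y(1) unfolding M.indep_vars_def2 N.indep_vars_def2 by auto
  show ?thesis
  proof (rule Levy_uniqueness)
    show "real_distribution (distr M borel (\<lambda>\<omega>. \<Sum>i\<in>I. X i \<omega>))"
      by (rule M.real_distribution_distr) measurable
    show "real_distribution (distr N borel (\<lambda>\<omega>. \<Sum>j\<in>J. Y j \<omega>))"
      by (rule N.real_distribution_distr) measurable
    show "char (distr M borel (\<lambda>\<omega>. \<Sum>i\<in>I. X i \<omega>)) = char (distr N borel (\<lambda>\<omega>. \<Sum>j\<in>J. Y j \<omega>))"
      using M.char_distr_sum_iid[OF X] N.char_distr_sum_iid[OF Y] card by simp
  qed
qed

text \<open>Independence says that the joint law is the product of the marginals; for the
  coordinates the joint law is the product measure itself and the marginals are its factors.\<close>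

lemma indep_vars_PiM_components:
  assumes M: "\<And>i. i \<in> I \<Longrightarrow> prob_space (M i)" and "I \<noteq> {}"
  shows "prob_space.indep_vars (PiM I M) M (\<lambda>i \<omega>. \<omega> i) I"
proof -
  interpret P: prob_space "PiM I M" using M by (rule prob_space_PiM)
  \<comment> \<open>Points of the product space are extensional, so restricting to I changes nothing
    there.\<close>
  have "distr (PiM I M) (PiM I M) (\<lambda>x. \<lambda>i\<in>I. x i) = distr (PiM I M) (PiM I M) (\<lambda>x. x)"
    by (rule distr_cong) (auto simp: space_PiM intro!: PiE_restrict)
  also have "\<dots> = PiM I M" by (rule distr_id)
  also have "\<dots> = (\<Pi>\<^sub>M i\<in>I. distr (PiM I M) (M i) (\<lambda>\<omega>. \<omega> i))"
    using M by (intro PiM_cong refl) (simp add: distr_PiM_component)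
  finally show ?thesis
    using \<open>I \<noteq> {}\<close> by (subst P.indep_vars_iff_distr_eq_PiM') auto
qed

text \<open>The rows may live on different probability spaces; the normalised row sums have the same laws
  as those of the coordinates of an infinite product of \<open>\<nu>\<close>, to which the classical theorem applies.\<close>
theorem central_limit_theorem_iid_rows:
  fixes N :: "nat \<Rightarrow> 'a measure" and X :: "nat \<Rightarrow> nat \<Rightarrow> 'a \<Rightarrow> real"
  assumes \<nu>: "real_distribution \<nu>" "integrable \<nu> (\<lambda>x. x\<^sup>2)"
    and mean: "(\<integral>x. x \<partial>\<nu>) = \<mu>" and var: "(\<integral>x. (x - \<mu>)\<^sup>2 \<partial>\<nu>) = \<sigma>\<^sup>2" and \<sigma>: "\<sigma> > 0"
    and N: "\<And>m. m \<ge> 1 \<Longrightarrow> prob_space (N m)"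
    and X: "\<And>m. m \<ge> 1 \<Longrightarrow> prob_space.indep_vars (N m) (\<lambda>_. borel) (X m) {1..m}"
      "\<And>m i. i \<in> {1..m} \<Longrightarrow> distr (N m) borel (X m i) = \<nu>"
  shows "weak_conv_m
    (\<lambda>m. distr (N m) borel (\<lambda>\<omega>. ((\<Sum>i=1..m. X m i \<omega>) - real m * \<mu>) / sqrt (real m * \<sigma>\<^sup>2)))
    std_normal_distribution"
proof -
  interpret \<nu>: real_distribution \<nu> by fact
  let ?P = "PiM UNIV (\<lambda>_::nat. \<nu>)"
  interpret P: prob_space ?P by (rule prob_space_PiM) (rule \<nu>.prob_space_axioms)
  define Y where "Y i \<omega> = \<omega> i" for i :: nat and \<omega> :: "nat \<Rightarrow> real"
  have [measurable]: "Y i \<in> borel_measurable ?P" for i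
    using measurable_component_singleton[of i UNIV "\<lambda>_. \<nu>"] unfolding Y_def
    by (simp add: measurable_cong_sets[OF refl \<nu>.events_eq_borel])
  have "P.indep_vars (\<lambda>_. \<nu>) Y UNIV"
    unfolding Y_def by (rule indep_vars_PiM_components) (auto intro: \<nu>.prob_space_axioms)
  then have indY: "P.indep_vars (\<lambda>_. borel) Y UNIV"
    by (rule P.indep_vars_compose2[where Y="\<lambda>_ x. x"]) (simp add: measurable_ident_sets)
  have distrY: "distr ?P borel (Y i) = \<nu>" for i
  proof -
    have "distr ?P borel (Y i) = distr ?P \<nu> (Y i)" by (rule distr_cong) auto
    also have "\<dots> = \<nu>" unfolding Y_def
      by (rule distr_PiM_component) (auto intro: \<nu>.prob_space_axioms)
    finally show ?thesis .
  qed
  have EY: "P.expectation (\<lambda>\<omega>. f (Y i \<omega>)) = (\<integral>x. f x \<partial>\<nu>)" if [measurable]: "f \<in> borel_measurable borel"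
    for f :: "real \<Rightarrow> real" and i
    using integral_distr[of "Y i" ?P borel f] by (simp add: distrY)
  have IY: "integrable ?P (\<lambda>\<omega>. (Y i \<omega>)\<^sup>2)" for i
    using \<nu>(2) integrable_distr_eq[of "Y i" ?P borel "\<lambda>x. x\<^sup>2"] by (simp add: distrY)
  have meanY: "P.expectation (Y i) = \<mu>" for i
    using EY[of "\<lambda>x. x" i] mean by simp
  have lim: "weak_conv_m (\<lambda>m. distr ?P borel (\<lambda>\<omega>. (\<Sum>i<m. Y i \<omega> - \<mu>) / sqrt (real m * \<sigma>\<^sup>2)))
      std_normal_distribution"
    using EY[of "\<lambda>x. (x - \<mu>)\<^sup>2"] var
    by (intro P.central_limit_theorem[OF indY meanY \<sigma> IY _ distrY]) (simp add: meanY)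
  \<comment> \<open>Row 0 carries no assumption that makes it a probability space; a limit ignores
    it.\<close>
  have eq: "distr ?P borel (\<lambda>\<omega>. (\<Sum>i<m. Y i \<omega> - \<mu>) / sqrt (real m * \<sigma>\<^sup>2))
      = distr (N m) borel (\<lambda>\<omega>. ((\<Sum>i=1..m. X m i \<omega>) - real m * \<mu>) / sqrt (real m * \<sigma>\<^sup>2))"
    if m: "m \<ge> 1" for m
  proof -
    interpret N: prob_space "N m" using N m by simp
    have [measurable]: "i \<in> {1..m} \<Longrightarrow> X m i \<in> borel_measurable (N m)" for i
      using X(1)[OF m] unfolding N.indep_vars_def2 by auto
    let ?g = "\<lambda>s. (s - real m * \<mu>) / sqrt (real m * \<sigma>\<^sup>2)"
    \<comment> \<open>The index sets \<open>{..<m}\<close> and \<open>{1..m}\<close> enter only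
      through their common cardinality.\<close>
    have "distr ?P borel (\<lambda>\<omega>. \<Sum>i<m. Y i \<omega>) = distr (N m) borel (\<lambda>\<omega>. \<Sum>i=1..m. X m i \<omega>)"
    proof (rule distr_sum_iid_cong[OF P.prob_space_axioms _ _ N.prob_space_axioms X(1)[OF m]])
      show "P.indep_vars (\<lambda>_. borel) Y {..<m}" by (rule P.indep_vars_subset[OF indY]) auto
    qed (auto simp: distrY X(2))
    then have "distr (distr ?P borel (\<lambda>\<omega>. \<Sum>i<m. Y i \<omega>)) borel ?g
        = distr (distr (N m) borel (\<lambda>\<omega>. \<Sum>i=1..m. X m i \<omega>)) borel ?g" by simp
    then show ?thesis by (simp add: distr_distr comp_def sum_subtractf)
  qed
  show ?thesis
    unfolding weak_conv_m_def weak_conv_def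
  proof (intro allI impI)
    fix x
    assume "isCont (cdf std_normal_distribution) x"
    with lim have "(\<lambda>m. cdf (distr ?P borel (\<lambda>\<omega>. (\<Sum>i<m. Y i \<omega> - \<mu>) / sqrt (real m * \<sigma>\<^sup>2))) x)
      \<longlonglongrightarrow> cdf std_normal_distribution x"
      unfolding weak_conv_m_def weak_conv_def by blast
    then show "(\<lambda>m. cdf (distr (N m) borel
        (\<lambda>\<omega>. ((\<Sum>i=1..m. X m i \<omega>) - real m * \<mu>) / sqrt (real m * \<sigma>\<^sup>2))) x)
      \<longlonglongrightarrow> cdf std_normal_distribution x"
      by (rule Lim_transform_eventually) (use eq in \<open>auto intro!: eventually_sequentiallyI[of 1]\<close>)
  qed
qed

section \<open>Coverage of the Wald interval\<close>

text \<open>Without atoms the limiting \<open>cdf\<close> is continuous, so weak convergence gives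
  convergence of \<open>cdf\<close> at every point.\<close>

lemma measure_std_normal_singleton: "measure std_normal_distribution {x} = 0"
proof -
  have "emeasure std_normal_distribution {x} = 0"
    by (subst emeasure_density)
      (auto simp: nn_integral_0_iff_AE intro!: AE_mp[OF AE_lborel_singleton[of x]])
  then show ?thesis by (simp add: measure_def)
qed

text \<open>The event \<open>E m\<close> need not be determined by \<open>T m\<close>. It lies
  between the events that \<open>T m\<close> is in (-(c-e), c-e] and in (-(c+e), c+e], whose
  probabilities converge to masses under \<nu>; these approach the mass of [-c, c] as e tends to
  0.\<close>

lemma weak_conv_m_sandwiched_event:
  fixes N :: "nat \<Rightarrow> 'a measure" and T :: "nat \<Rightarrow> 'a \<Rightarrow> real" and c :: real
  assumes conv: "weak_conv_m (\<lambda>m. distr (N m) borel (T m)) \<nu>"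
    and \<nu>: "real_distribution \<nu>" "\<And>x. measure \<nu> {x} = 0" and c: "c > 0"
    and N: "\<And>m. m \<ge> 1 \<Longrightarrow> prob_space (N m)"
    and T: "\<And>m. m \<ge> 1 \<Longrightarrow> T m \<in> borel_measurable (N m)"
    and E: "\<And>m. m \<ge> 1 \<Longrightarrow> E m \<in> sets (N m)"
    and sandwich: "\<And>e. 0 < e \<Longrightarrow> e < c \<Longrightarrow> eventually (\<lambda>m. \<forall>\<omega>\<in>space (N m).
      (\<bar>T m \<omega>\<bar> \<le> c - e \<longrightarrow> \<omega> \<in> E m) \<and> (\<omega> \<in> E m \<longrightarrow> \<bar>T m \<omega>\<bar> < c + e)) sequentially"
  shows "(\<lambda>m. measure (N m) (E m)) \<longlonglongrightarrow> measure \<nu> {-c..c}"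
proof -
  interpret \<nu>: real_distribution \<nu> by fact
  \<comment> \<open>For a > 0 this is the mass of the half-open interval (-a, a], the form that
    differences of \<open>cdf\<close> deliver; the missing endpoint has mass zero under
    \<nu>.\<close>
  define G where "G M a = cdf M a - cdf M (- a)" for M :: "real measure" and a :: real
  have cont: "isCont (cdf \<nu>) a" for a
    using \<nu>(2) \<nu>.isCont_cdf by blast
  have contG: "isCont (G \<nu>) a" for a
    unfolding G_def by (rule isCont_diff[OF cont isCont_o2[OF continuous_minus[OF continuous_ident] cont]])
  have Gc: "measure \<nu> {-c..c} = G \<nu> c"
  proof -
    have "{-c..c} = {-c} \<union> {-c<..c}" using c by auto
    then have "measure \<nu> {-c..c} = measure \<nu> {-c} + measure \<nu> {-c<..c}"
      by (simp only:) (rule \<nu>.finite_measure_Union, auto)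
    then show ?thesis using \<nu>(2) \<nu>.cdf_diff_eq[of "-c" c] c by (simp add: G_def)
  qed
  have convG: "(\<lambda>m. G (distr (N m) borel (T m)) a) \<longlonglongrightarrow> G \<nu> a" for a
    unfolding G_def using conv cont unfolding weak_conv_m_def weak_conv_def
    by (intro tendsto_diff) blast+
  have G_eq: "G (distr (N m) borel (T m)) a = measure (N m) {\<omega> \<in> space (N m). - a < T m \<omega> \<and> T m \<omega> \<le> a}"
    if m: "m \<ge> 1" and a: "a > 0" for m a
  proof -
    interpret N: prob_space "N m" using N m .
    have [measurable]: "T m \<in> borel_measurable (N m)" using T m .
    interpret D: real_distribution "distr (N m) borel (T m)" by (rule N.real_distribution_distr) simp
    have "G (distr (N m) borel (T m)) a = measure (distr (N m) borel (T m)) {-a<..a}"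
      unfolding G_def using a by (intro D.cdf_diff_eq) simp
    also have "\<dots> = measure (N m) {\<omega> \<in> space (N m). - a < T m \<omega> \<and> T m \<omega> \<le> a}"
      by (subst measure_distr) (auto intro!: arg_cong[where f="measure (N m)"])
    finally show ?thesis .
  qed
  have bound: "eventually (\<lambda>m. G (distr (N m) borel (T m)) (c - e) \<le> measure (N m) (E m) \<and>
      measure (N m) (E m) \<le> G (distr (N m) borel (T m)) (c + e)) sequentially"
    if e: "0 < e" "e < c" for e
    using sandwich[OF e] eventually_ge_at_top[of 1]
  proof eventually_elim
    case (elim m)
    interpret N: prob_space "N m" using N elim(2) .
    have [measurable]: "T m \<in> borel_measurable (N m)" "E m \<in> sets (N m)" using T E elim(2) by auto
    have "E m \<subseteq> space (N m)" using sets.sets_into_space[of "E m"] by simp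
    then have "{\<omega> \<in> space (N m). - (c - e) < T m \<omega> \<and> T m \<omega> \<le> c - e} \<subseteq> E m"
        "E m \<subseteq> {\<omega> \<in> space (N m). - (c + e) < T m \<omega> \<and> T m \<omega> \<le> c + e}"
      using elim(1) by (fastforce simp: abs_le_iff abs_less_iff)+
    moreover have "c - e > 0" "c + e > 0" using e by auto
    ultimately show ?case
      by (simp add: G_eq[OF elim(2)] N.finite_measure_mono)
  qed
  have lim: "((\<lambda>e. G \<nu> (c - e)) \<longlongrightarrow> G \<nu> c) (at_right 0)" "((\<lambda>e. G \<nu> (c + e)) \<longlongrightarrow> G \<nu> c) (at_right 0)"
    by (rule isCont_tendsto_compose[OF contG] tendsto_eq_intros | simp)+
  have small: "eventually (\<lambda>e. 0 < e \<and> e < c) (at_right 0)"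
    using c by (auto simp: eventually_at_right_field)
  show ?thesis unfolding Gc
  proof (rule order_tendstoI)
    fix a assume "a < G \<nu> c"
    \<comment> \<open>The margin e is fixed before m grows, because the threshold in
      \<open>bound\<close> depends on e.\<close>
    then obtain e where e: "0 < e" "e < c" "a < G \<nu> (c - e)"
      using eventually_happens'[OF trivial_limit_at_right_real
          eventually_conj[OF small order_tendstoD(1)[OF lim(1)]]] by auto
    show "eventually (\<lambda>m. a < measure (N m) (E m)) sequentially"
      using order_tendstoD(1)[OF convG e(3)] bound[OF e(1,2)] by eventually_elim simp
  next
    fix a assume "a > G \<nu> c"
    then obtain e where e: "0 < e" "e < c" "a > G \<nu> (c + e)"
      using eventually_happens'[OF trivial_limit_at_right_real
          eventually_conj[OF small order_tendstoD(2)[OF lim(2)]]] by auto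
    show "eventually (\<lambda>m. a > measure (N m) (E m)) sequentially"
      using order_tendstoD(2)[OF convG e(3)] bound[OF e(1,2)] by eventually_elim simp
  qed
qed

text \<open>Squaring removes both roots and leaves a polynomial inequality in x, convenient for
  estimates and for measurability.\<close>

lemma wald_interval_iff:
  fixes p x c :: real
  assumes x: "0 \<le> x" "x \<le> 1" and c: "0 \<le> c" and m: "m \<ge> (1::nat)"
  shows "p \<in> {x - c * sqrt (x * (1 - x)) / sqrt (real m) .. x + c * sqrt (x * (1 - x)) / sqrt (real m)}
     \<longleftrightarrow> real m * (x - p)\<^sup>2 \<le> c\<^sup>2 * (x * (1 - x))"
proof -
  have m0: "sqrt (real m) > 0" using m by simp
  have nn: "0 \<le> c * sqrt (x * (1 - x))" using x c by simp
  have "p \<in> {x - c * sqrt (x * (1 - x)) / sqrt (real m) .. x + c * sqrt (x * (1 - x)) / sqrt (real m)}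
      \<longleftrightarrow> \<bar>x - p\<bar> \<le> c * sqrt (x * (1 - x)) / sqrt (real m)"
    by (auto simp: abs_le_iff)
  also have "\<dots> \<longleftrightarrow> sqrt (real m) * \<bar>x - p\<bar> \<le> c * sqrt (x * (1 - x))"
    using m0 by (simp add: pos_le_divide_eq mult.commute)
  also have "\<dots> \<longleftrightarrow> (sqrt (real m) * \<bar>x - p\<bar>)\<^sup>2 \<le> (c * sqrt (x * (1 - x)))\<^sup>2"
    using nn m0 by (subst power2_le_iff_abs_le) (auto simp: abs_mult)
  also have "\<dots> \<longleftrightarrow> real m * (x - p)\<^sup>2 \<le> c\<^sup>2 * (x * (1 - x))"
    using x by (simp add: power_mult_distrib)
  finally show ?thesis .
qed

text \<open>Either hypothesis forces |x - p| to be of order 1 / sqrt m, so the estimated variance x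
  (1 - x) is that close to \<open>v\<close>, and the margin e absorbs the difference. The thresholds
  for m do not involve x.\<close>

lemma eventually_wald_interval_sandwich:
  fixes p c e :: real
  assumes p: "0 < p" "p < 1" and e: "0 < e" "e < c"
  shows "eventually (\<lambda>m. \<forall>x\<in>{0..1}.
     (\<bar>sqrt (real m / (p * (1 - p))) * (x - p)\<bar> \<le> c - e \<longrightarrow> real m * (x - p)\<^sup>2 \<le> c\<^sup>2 * (x * (1 - x))) \<and>
     (real m * (x - p)\<^sup>2 \<le> c\<^sup>2 * (x * (1 - x)) \<longrightarrow> \<bar>sqrt (real m / (p * (1 - p))) * (x - p)\<bar> < c + e))
    sequentially"
proof -
  define v where "v = p * (1 - p)"
  have v: "v > 0" using p by (simp add: v_def)
  have inv0: "(\<lambda>m. 1 / sqrt (real m)) \<longlonglongrightarrow> 0"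
    by (intro tendsto_divide_0[OF tendsto_const] filterlim_at_top_imp_at_infinity
        filterlim_compose[OF sqrt_at_top filterlim_real_sequentially])
  \<comment> \<open>If |T| \<le> c then |x - p| is at most \<open>c * sqrt v / sqrt m\<close>, and x
    (1 - x) falls below \<open>v\<close> by at most twice that: once for the linear and once for the
    quadratic term.\<close>
  have "(\<lambda>m. c\<^sup>2 * (v - 2 * (c * sqrt v) * (1 / sqrt (real m)))) \<longlonglongrightarrow> c\<^sup>2 * (v - 2 * (c * sqrt v) * 0)"
    by (intro tendsto_intros inv0)
  moreover have "(c - e)\<^sup>2 * v < c\<^sup>2 * (v - 2 * (c * sqrt v) * 0)"
    using e v by (simp add: power_strict_mono)
  ultimately have ev1: "eventually (\<lambda>m. (c - e)\<^sup>2 * v < c\<^sup>2 * (v - 2 * (c * sqrt v) * (1 / sqrt (real m)))) sequentially"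
    by (rule order_tendstoD(1))
  \<comment> \<open>In this direction the quadratic term only helps, so a single |x - p| \<le> c /
    sqrt m is lost.\<close>
  have "(\<lambda>m. c\<^sup>2 * (v + c * (1 / sqrt (real m)))) \<longlonglongrightarrow> c\<^sup>2 * (v + c * 0)"
    by (intro tendsto_intros inv0)
  moreover have "c\<^sup>2 * (v + c * 0) < (c + e)\<^sup>2 * v"
    using e v by (simp add: power_strict_mono)
  ultimately have ev2: "eventually (\<lambda>m. c\<^sup>2 * (v + c * (1 / sqrt (real m))) < (c + e)\<^sup>2 * v) sequentially"
    by (rule order_tendstoD(2))
  show ?thesis
    using ev1 ev2 eventually_ge_at_top[of 1]
  proof (eventually_elim, intro ballI conjI impI)
    fix m :: nat and x :: real
    assume m: "1 \<le> m" and x: "x \<in> {0..1}"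
    let ?T = "sqrt (real m / (p * (1 - p))) * (x - p)"
    have m0: "sqrt (real m) > 0" using m by simp
    have T2: "?T\<^sup>2 * v = real m * (x - p)\<^sup>2"
      using v unfolding v_def[symmetric] by (simp add: power_mult_distrib)
    \<comment> \<open>Taylor expansion of the variance function about p.\<close>
    have var: "x * (1 - x) = v + (1 - 2 * p) * (x - p) - (x - p)\<^sup>2"
      by (simp add: v_def power2_eq_square algebra_simps)
    have d1: "\<bar>x - p\<bar> \<le> 1" using x p by auto
    have lin: "\<bar>(1 - 2 * p) * (x - p)\<bar> \<le> \<bar>x - p\<bar>"
      unfolding abs_mult by (rule mult_left_le_one_le) (use p in \<open>auto simp: abs_le_iff\<close>)
    have quad: "(x - p)\<^sup>2 \<le> \<bar>x - p\<bar>"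
      using mult_left_le[OF d1 abs_ge_zero[of "x - p"]]
      by (simp add: power2_eq_square flip: abs_mult)
    {
      assume 1: "(c - e)\<^sup>2 * v < c\<^sup>2 * (v - 2 * (c * sqrt v) * (1 / sqrt (real m)))"
        and T: "\<bar>?T\<bar> \<le> c - e"
      have "\<bar>?T\<bar> = sqrt (real m) / sqrt v * \<bar>x - p\<bar>"
        using v by (simp add: abs_mult v_def real_sqrt_divide)
      then have "sqrt (real m) / sqrt v * \<bar>x - p\<bar> \<le> c" using T e by simp
      then have "\<bar>x - p\<bar> \<le> c * sqrt v * (1 / sqrt (real m))"
        using m0 v by (simp add: field_simps)
      then have "v - 2 * (c * sqrt v) * (1 / sqrt (real m)) \<le> x * (1 - x)"
        using var lin quad by linarith
      then have "c\<^sup>2 * (v - 2 * (c * sqrt v) * (1 / sqrt (real m))) \<le> c\<^sup>2 * (x * (1 - x))"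
        by (rule mult_left_mono) simp
      moreover have "?T\<^sup>2 \<le> (c - e)\<^sup>2" using T e by (simp add: power2_le_iff_abs_le)
      then have "?T\<^sup>2 * v \<le> (c - e)\<^sup>2 * v" using v by (intro mult_right_mono) auto
      ultimately show "real m * (x - p)\<^sup>2 \<le> c\<^sup>2 * (x * (1 - x))"
        using 1 T2 by linarith
    }
    {
      assume 2: "c\<^sup>2 * (v + c * (1 / sqrt (real m))) < (c + e)\<^sup>2 * v"
        and I: "real m * (x - p)\<^sup>2 \<le> c\<^sup>2 * (x * (1 - x))"
      \<comment> \<open>This crude bound already gives the order 1 / sqrt m, after which the sharper
        estimate of x (1 - x) becomes available.\<close>
      have "x * (1 - x) \<le> 1" using x by (intro mult_le_one) auto
      then have "c\<^sup>2 * (x * (1 - x)) \<le> c\<^sup>2 * 1" by (intro mult_left_mono) auto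
      with I have "(sqrt (real m) * (x - p))\<^sup>2 \<le> c\<^sup>2" by (simp add: power_mult_distrib)
      then have "sqrt (real m) * \<bar>x - p\<bar> \<le> c"
        using e by (simp add: power2_le_iff_abs_le abs_mult)
      then have "\<bar>x - p\<bar> \<le> c * (1 / sqrt (real m))"
        using m0 by (simp add: field_simps)
      then have "x * (1 - x) \<le> v + c * (1 / sqrt (real m))"
        using var lin zero_le_power2[of "x - p"] by linarith
      then have "c\<^sup>2 * (x * (1 - x)) \<le> c\<^sup>2 * (v + c * (1 / sqrt (real m)))"
        by (rule mult_left_mono) simp
      then have "?T\<^sup>2 * v < (c + e)\<^sup>2 * v" using I 2 T2 by linarith
      then have "\<bar>?T\<bar>\<^sup>2 < (c + e)\<^sup>2" unfolding power2_abs using v by (simp only: mult_less_cancel_right_pos)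
      then show "\<bar>?T\<bar> < c + e" by (rule power2_less_imp_less) (use e in simp)
    }
  qed
qed

section \<open>The minhashing estimator\<close>

lemma perms_inj_on: "p \<in> perms n \<Longrightarrow> inj_on p A"
  by (auto simp: perms_def dest: permutes_inj inj_on_subset)

text \<open>For two empty sets the minima always agree, while \<open>similarity\<close> is 0/0 = 0;
  hence the condition on the union.\<close>

lemma measure_uniform_perms_min_over_eq:
  assumes "A \<subseteq> {1..n}" "B \<subseteq> {1..n}" "A \<union> B \<noteq> {}"
  shows "measure (uniform_count_measure (perms n)) {p \<in> perms n. min_over p A = min_over p B}
    = similarity A B"
proof -
  have "card (A \<union> B) > 0"
    using assms by (metis card_gt_0_iff finite_atLeastAtMost finite_subset Un_least)
  have "{p \<in> perms n. min_over p A = min_over p B}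
      = {p \<in> perms n. \<exists>i\<in>A \<inter> B. \<forall>l\<in>A \<union> B. p i \<le> p l}" (is "?L = ?R")
    using min_over_eq_iff_argmin[OF perms_inj_on assms(3)] by blast
  then have "measure (uniform_count_measure (perms n)) ?L = real (card ?R) / fact n"
    by (subst measure_uniform_count_measure) (auto simp: finite_perms card_perms)
  moreover have "real (card (A \<union> B)) * real (card ?R) = real (card (A \<inter> B)) * fact n"
  proof -
    have "card (A \<union> B) * card ?R = card (A \<inter> B) * fact n"
      by (rule card_perms_argmin_in) (use assms in blast)+
    from this[THEN arg_cong, of real] show ?thesis by (simp only: of_nat_mult of_nat_fact)
  qed
  then have "real (card ?R) / fact n = similarity A B"
    using \<open>card (A \<union> B) > 0\<close> by (simp add: similarity_def frac_eq_eq mult.commute)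
  ultimately show ?thesis by simp
qed

section \<open>Bounds for the similarity, and Bernoulli laws on the reals\<close>

lemma similarity_nonneg: "0 \<le> similarity A B"
  by (simp add: similarity_def)

lemma similarity_le_1:
  assumes "finite A" "finite B"
  shows "similarity A B \<le> 1"
proof -
  have "card (A \<inter> B) \<le> card (A \<union> B)" using assms by (intro card_mono) auto
  then show ?thesis by (auto simp: similarity_def divide_le_eq_1)
qed

text \<open>A finite measure on \<open>bool\<close> is determined by its two singletons; pushing
  forward along \<open>of_bool\<close> then gives equality of the real laws.\<close>

lemma (in prob_space) distr_of_bool:
  assumes P [measurable]: "Measurable.pred M P"
  shows "distr M borel (\<lambda>\<omega>. of_bool (P \<omega>) :: real)
    = distr (measure_pmf (bernoulli_pmf (prob {\<omega>\<in>space M. P \<omega>}))) borel of_bool"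
proof -
  let ?p = "prob {\<omega>\<in>space M. P \<omega>}"
  have "distr M (count_space UNIV) P = measure_pmf (bernoulli_pmf ?p)"
  proof (rule measure_eqI_finite[where A = UNIV])
    fix a :: bool
    have "prob {\<omega>\<in>space M. \<not> P \<omega>} = 1 - ?p" by (rule prob_neg) simp
    then have "prob (P -` {a} \<inter> space M) = pmf (bernoulli_pmf ?p) a"
      by (cases a) (auto simp: vimage_def Int_def conj_commute)
    then show "emeasure (distr M (count_space UNIV) P) {a} = emeasure (measure_pmf (bernoulli_pmf ?p)) {a}"
      by (simp add: emeasure_distr emeasure_eq_measure emeasure_pmf_single)
  qed auto
  then have "distr (distr M (count_space UNIV) P) borel (of_bool :: bool \<Rightarrow> real)
      = distr (measure_pmf (bernoulli_pmf ?p)) borel of_bool" by simp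
  then show ?thesis by (simp add: distr_distr comp_def)
qed

text \<open>\<open>bernoulli_pmf\<close> lives on \<open>bool\<close>; moments and characteristic
  functions of the summands need its image on the Borel reals.\<close>

abbreviation (input) bernoulli_law :: "real \<Rightarrow> real measure" where
  "bernoulli_law p \<equiv> distr (measure_pmf (bernoulli_pmf p)) borel of_bool"

lemma real_distribution_bernoulli_law: "real_distribution (bernoulli_law p)"
  by (rule prob_space.real_distribution_distr[OF measure_pmf.prob_space_axioms]) simp

text \<open>\<open>bernoulli_pmf\<close> clips its parameter to [0,1], so the weights are p and 1 -
  p only within these bounds.\<close>

lemma integral_bernoulli_law:
  assumes "0 \<le> p" "p \<le> 1" and f: "f \<in> borel_measurable borel"
  shows "(\<integral>x. f x \<partial>bernoulli_law p) = f 1 * p + f 0 * (1 - p :: real)"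
  using assms by (simp add: integral_distr)

lemma integrable_bernoulli_law:
  fixes f :: "real \<Rightarrow> real"
  assumes f: "f \<in> borel_measurable borel"
  shows "integrable (bernoulli_law p) f"
  using assms by (simp add: integrable_distr_eq integrable_measure_pmf_finite)

text \<open>Fixes one sample size; the limit statements instantiate it for every row m with k = m
  and the space of that row.\<close>

locale minhash =
  fixes n k :: nat and A B :: "nat set" and M :: "'w measure" and Z :: "nat \<Rightarrow> 'w \<Rightarrow> nat \<Rightarrow> nat"
  assumes A: "A \<subseteq> {1..n}" and B: "B \<subseteq> {1..n}" and ne: "A \<union> B \<noteq> {}"
    and k: "k \<ge> 1" and iid: "iid_uniform_perms n k M Z"
begin

sublocale prob_space M
  using iid by (simp add: iid_uniform_perms_def)

abbreviation "sim \<equiv> similarity A B"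

lemma sim_bounds: "0 \<le> sim" "sim \<le> 1"
  using similarity_nonneg similarity_le_1[OF finite_subset[OF A] finite_subset[OF B]] by auto

lemma indep_Z: "indep_vars (\<lambda>_. count_space (perms n)) Z {1..k}"
  using iid by (simp add: iid_uniform_perms_def)

lemma measurable_Z: "\<alpha> \<in> {1..k} \<Longrightarrow> Z \<alpha> \<in> measurable M (count_space (perms n))"
  using indep_Z unfolding indep_vars_def2 by blast

lemma Z_in_perms: "\<alpha> \<in> {1..k} \<Longrightarrow> \<omega> \<in> space M \<Longrightarrow> Z \<alpha> \<omega> \<in> perms n"
  using measurable_space[OF measurable_Z] by simp

lemma pred_min_over_eq:
  assumes "\<alpha> \<in> {1..k}"
  shows "Measurable.pred M (\<lambda>\<omega>. min_over (Z \<alpha> \<omega>) A = min_over (Z \<alpha> \<omega>) B)"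
  by (rule measurable_compose[OF measurable_Z[OF assms]]) simp

lemma prob_min_over_eq:
  assumes \<alpha>: "\<alpha> \<in> {1..k}"
  shows "prob {\<omega>\<in>space M. min_over (Z \<alpha> \<omega>) A = min_over (Z \<alpha> \<omega>) B} = sim"
proof -
  let ?Q = "{p \<in> perms n. min_over p A = min_over p B}"
  have "{\<omega>\<in>space M. min_over (Z \<alpha> \<omega>) A = min_over (Z \<alpha> \<omega>) B} = Z \<alpha> -` ?Q \<inter> space M"
    using Z_in_perms[OF \<alpha>] by auto
  also have "prob \<dots> = measure (distr M (count_space (perms n)) (Z \<alpha>)) ?Q"
    by (rule measure_distr[OF measurable_Z[OF \<alpha>], symmetric]) simp
  also have "distr M (count_space (perms n)) (Z \<alpha>) = uniform_count_measure (perms n)"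
    using iid \<alpha> by (simp add: iid_uniform_perms_def)
  finally show ?thesis
    using measure_uniform_perms_min_over_eq[OF A B ne] by simp
qed

lemma distr_agree:
  assumes \<alpha>: "\<alpha> \<in> {1..k}"
  shows "distr M borel (agree Z A B \<alpha>) = bernoulli_law sim"
proof -
  have "agree Z A B \<alpha> = (\<lambda>\<omega>. of_bool (min_over (Z \<alpha> \<omega>) A = min_over (Z \<alpha> \<omega>) B))"
    by (auto simp: agree_def)
  then show ?thesis
    using distr_of_bool[OF pred_min_over_eq[OF \<alpha>]] prob_min_over_eq[OF \<alpha>] by simp
qed

lemma indep_agree: "indep_vars (\<lambda>_. borel) (agree Z A B) {1..k}"
proof -
  have "agree Z A B = (\<lambda>\<alpha> \<omega>. (\<lambda>z. if min_over z A = min_over z B then 1 else 0) (Z \<alpha> \<omega>))"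
    by (auto simp: agree_def fun_eq_iff)
  then show ?thesis
    by (simp only:) (rule indep_vars_compose2[OF indep_Z], simp)
qed

lemma measurable_agree: "\<alpha> \<in> {1..k} \<Longrightarrow> agree Z A B \<alpha> \<in> borel_measurable M"
  using indep_agree unfolding indep_vars_def2 by blast

text \<open>A general f covers the mean (identity) and the variance (centred square) at
  once.\<close>

lemma expectation_agree:
  assumes \<alpha>: "\<alpha> \<in> {1..k}" and f: "f \<in> borel_measurable borel"
  shows "expectation (\<lambda>\<omega>. f (agree Z A B \<alpha> \<omega>)) = f 1 * sim + f 0 * (1 - sim :: real)"
  using integral_distr[OF measurable_agree[OF \<alpha>] f]
    integral_bernoulli_law[OF sim_bounds f] distr_agree[OF \<alpha>] by simp

lemma integrable_agree:
  fixes f :: "real \<Rightarrow> real"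
  assumes \<alpha>: "\<alpha> \<in> {1..k}" and f: "f \<in> borel_measurable borel"
  shows "integrable M (\<lambda>\<omega>. f (agree Z A B \<alpha> \<omega>))"
  using integrable_distr_eq[OF measurable_agree[OF \<alpha>] f]
    integrable_bernoulli_law[OF f] distr_agree[OF \<alpha>] by simp

lemma measurable_simrum: "simrum k Z A B \<in> borel_measurable M"
  unfolding simrum_def[abs_def]
  by (intro borel_measurable_times borel_measurable_const borel_measurable_sum measurable_agree)

lemma sum_agree_eq: "(\<Sum>\<alpha>=1..k. agree Z A B \<alpha> \<omega>) = real k * simrum k Z A B \<omega>"
  using k by (simp add: simrum_def)

text \<open>Keeps x (1 - x) nonnegative, as the interval with the estimated variance
  requires.\<close>

lemma simrum_bounds: "simrum k Z A B \<omega> \<in> {0..1}"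
proof -
  have "(\<Sum>\<alpha>=1..k. agree Z A B \<alpha> \<omega>) \<le> (\<Sum>\<alpha>=1..k. 1)"
    by (rule sum_mono) (simp add: agree_def)
  moreover have "0 \<le> (\<Sum>\<alpha>=1..k. agree Z A B \<alpha> \<omega>)"
    by (rule sum_nonneg) (simp add: agree_def)
  ultimately show ?thesis using k by (simp add: simrum_def)
qed

lemma expectation_simrum: "expectation (simrum k Z A B) = sim"
proof -
  have "expectation (simrum k Z A B) = 1 / real k * (\<Sum>\<alpha>=1..k. expectation (agree Z A B \<alpha>))"
    unfolding simrum_def[abs_def] using integrable_agree[of _ "\<lambda>x. x"]
    by (subst integral_mult_right_zero) (subst Bochner_Integration.integral_sum, auto)
  also have "(\<Sum>\<alpha>=1..k. expectation (agree Z A B \<alpha>)) = (\<Sum>\<alpha>=1..k. sim)"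
    using expectation_agree[of _ "\<lambda>x. x"] by (intro sum.cong) auto
  finally show ?thesis using k by simp
qed

lemma variance_agree:
  assumes \<alpha>: "\<alpha> \<in> {1..k}"
  shows "variance (agree Z A B \<alpha>) = sim * (1 - sim)"
proof -
  have "expectation (agree Z A B \<alpha>) = sim"
    using expectation_agree[OF \<alpha>, of "\<lambda>x. x"] by simp
  then have "variance (agree Z A B \<alpha>) = (1 - sim)\<^sup>2 * sim + (0 - sim)\<^sup>2 * (1 - sim)"
    using expectation_agree[OF \<alpha>, of "\<lambda>x. (x - sim)\<^sup>2"] by simp
  then show ?thesis by (simp add: power2_eq_square algebra_simps)
qed

lemma integrable_simrum_square: "integrable M (\<lambda>\<omega>. (simrum k Z A B \<omega>)\<^sup>2)"
proof -
  have "integrable M (\<lambda>\<omega>. (1 / real k)\<^sup>2 * (\<Sum>\<alpha>=1..k. agree Z A B \<alpha> \<omega>)\<^sup>2)"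
    using integrable_agree[of _ "\<lambda>x. x\<^sup>2"]
    by (intro integrable_mult_right variance_sum_indep(1)[OF _ indep_agree]) auto
  then show ?thesis by (simp only: simrum_def power_mult_distrib)
qed

lemma variance_simrum: "variance (simrum k Z A B) = sim * (1 - sim) / real k"
proof -
  let ?S = "\<lambda>\<omega>. \<Sum>\<alpha>=1..k. agree Z A B \<alpha> \<omega>"
  have V: "variance ?S = (\<Sum>\<alpha>=1..k. variance (agree Z A B \<alpha>))"
    using variance_sum_indep(2)[OF _ indep_agree] integrable_agree[of _ "\<lambda>x. x\<^sup>2"] by auto
  have ES: "expectation ?S = real k * sim"
    unfolding sum_agree_eq by (simp add: expectation_simrum)
  have "simrum k Z A B \<omega> - sim = 1 / real k * (?S \<omega> - real k * sim)" for \<omega>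
    using k by (simp add: simrum_def field_simps)
  then have "variance (simrum k Z A B) = (1 / real k)\<^sup>2 * variance ?S"
    unfolding expectation_simrum ES by (simp only: power_mult_distrib integral_mult_right_zero)
  also have "variance ?S = real k * (sim * (1 - sim))"
    unfolding V by (simp add: variance_agree)
  finally show ?thesis using k by (simp add: power2_eq_square)
qed

lemma simrum_Chebyshev:
  assumes l: "l > 0"
  shows "prob {\<omega>\<in>space M. \<bar>simrum k Z A B \<omega> - sim\<bar> > l} \<le> sim * (1 - sim) / (real k * l\<^sup>2)"
proof -
  note [measurable] = measurable_simrum
  have "prob {\<omega>\<in>space M. \<bar>simrum k Z A B \<omega> - sim\<bar> > l}
      \<le> prob {\<omega>\<in>space M. \<bar>simrum k Z A B \<omega> - sim\<bar> \<ge> l}"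
    by (rule finite_measure_mono) auto
  also have "\<dots> \<le> variance (simrum k Z A B) / l\<^sup>2"
    using Chebyshev_inequality[OF measurable_simrum integrable_simrum_square l]
    unfolding expectation_simrum .
  finally show ?thesis unfolding variance_simrum by simp
qed

end

lemma (in minhash) min_over_eq_iff_Int_less:
  assumes "\<alpha> \<in> {1..k}" "\<omega> \<in> space M"
  shows "min_over (Z \<alpha> \<omega>) A = min_over (Z \<alpha> \<omega>) B \<longleftrightarrow>
    min_over (Z \<alpha> \<omega>) (A \<inter> B) < min_over (Z \<alpha> \<omega>) ((A - B) \<union> (B - A))"
  unfolding min_over_eq_iff_argmin[OF perms_inj_on[OF Z_in_perms[OF assms]] ne]
    min_over_Int_less_iff_argmin[OF perms_inj_on[OF Z_in_perms[OF assms]]] ..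

lemma (in minhash) mem_ci95_simrum_iff:
  "p \<in> ci95 k (simrum k Z A B \<omega>) \<longleftrightarrow>
    real k * (simrum k Z A B \<omega> - p)\<^sup>2 \<le> 1.96\<^sup>2 * (simrum k Z A B \<omega> * (1 - simrum k Z A B \<omega>))"
  unfolding ci95_def by (rule wald_interval_iff) (use simrum_bounds[of \<omega>] k in auto)

lemma (in minhash) ci95_event:
  "{\<omega> \<in> space M. p \<in> ci95 k (simrum k Z A B \<omega>)} \<in> sets M"
proof -
  note [measurable] = measurable_simrum
  show ?thesis unfolding mem_ci95_simrum_iff by measurable
qed

text \<open>The variance p (1 - p) must be positive. At p = 0 or p = 1 the standardised estimate is
  constantly 0, since division by zero yields 0, and the interval is almost surely {p}, so neither
  limit would hold.\<close>

theorem simrum_asymptotically_normal: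
  fixes N :: "nat \<Rightarrow> 'a measure"
  assumes A: "A \<subseteq> {1..n}" and B: "B \<subseteq> {1..n}" and ne: "A \<union> B \<noteq> {}"
    and iid: "\<And>m. m \<ge> 1 \<Longrightarrow> iid_uniform_perms n m (N m) (W m)"
    and sim: "similarity A B = p" "p \<noteq> 0" "p \<noteq> 1"
  shows "weak_conv_m (\<lambda>m. distr (N m) borel
      (\<lambda>\<omega>. sqrt (real m / (p * (1 - p))) * (simrum m (W m) A B \<omega> - p))) std_normal_distribution"
    and "(\<lambda>m. measure (N m) {\<omega>\<in>space (N m). p \<in> ci95 m (simrum m (W m) A B \<omega>)})
      \<longlonglongrightarrow> measure std_normal_distribution {-1.96..1.96}"
proof -
  have row: "minhash n m A B (N m) (W m)" if "m \<ge> 1" for m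
    using A B ne iid that by (simp add: minhash_def)
  have p: "0 < p" "p < 1"
    using sim minhash.sim_bounds[OF row[OF order_refl]] by auto
  let ?T = "\<lambda>m \<omega>. sqrt (real m / (p * (1 - p))) * (simrum m (W m) A B \<omega> - p)"
  let ?v = "p * (1 - p)"
  have v: "?v > 0" using p by simp
  have "weak_conv_m
    (\<lambda>m. distr (N m) borel (\<lambda>\<omega>. ((\<Sum>i=1..m. agree (W m) A B i \<omega>) - real m * p) / sqrt (real m * (sqrt ?v)\<^sup>2)))
    std_normal_distribution"
  proof (rule central_limit_theorem_iid_rows[where \<nu> = "bernoulli_law p"])
    show "(\<integral>x. x \<partial>bernoulli_law p) = p"
      using p by (subst integral_bernoulli_law) auto
    have "(\<integral>x. (x - p)\<^sup>2 \<partial>bernoulli_law p) = (1 - p)\<^sup>2 * p + (0 - p)\<^sup>2 * (1 - p)"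
      using p by (subst integral_bernoulli_law) auto
    also have "\<dots> = ?v" by (simp add: power2_eq_square algebra_simps)
    also have "\<dots> = (sqrt ?v)\<^sup>2" using v by (subst real_sqrt_pow2) auto
    finally show "(\<integral>x. (x - p)\<^sup>2 \<partial>bernoulli_law p) = (sqrt ?v)\<^sup>2" .
    show "prob_space (N m)" if "m \<ge> 1" for m
      using iid[OF that] by (simp add: iid_uniform_perms_def)
    show "prob_space.indep_vars (N m) (\<lambda>_. borel) (agree (W m) A B) {1..m}" if "m \<ge> 1" for m
      by (rule minhash.indep_agree[OF row[OF that]])
    show "distr (N m) borel (agree (W m) A B i) = bernoulli_law p" if "i \<in> {1..m}" for m i
      using minhash.distr_agree[OF row that] that sim(1) by simp
  qed (use v in \<open>auto intro: real_distribution_bernoulli_law integrable_bernoulli_law\<close>)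
  moreover have "((\<Sum>i=1..m. agree (W m) A B i \<omega>) - real m * p) / sqrt (real m * (sqrt ?v)\<^sup>2) = ?T m \<omega>" for m \<omega>
  proof (cases "m \<ge> 1")
    case True
    have "(\<Sum>i=1..m. agree (W m) A B i \<omega>) - real m * p = real m * (simrum m (W m) A B \<omega> - p)"
      unfolding minhash.sum_agree_eq[OF row[OF True]] by (simp add: right_diff_distrib)
    moreover have "real m / sqrt (real m * (sqrt ?v)\<^sup>2) = sqrt (real m / ?v)"
    proof -
      have "(sqrt ?v)\<^sup>2 = ?v" using v by (intro real_sqrt_pow2) simp
      then have "real m / sqrt (real m * (sqrt ?v)\<^sup>2) = real m / sqrt (real m) / sqrt ?v"
        by (simp only: real_sqrt_mult[of "real m"] divide_divide_eq_left)
      then show ?thesis by (simp only: real_div_sqrt[OF of_nat_0_le_iff] real_sqrt_divide)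
    qed
    ultimately show ?thesis by (metis times_divide_eq_left)
  \<comment> \<open>For m = 0 both sides are 0: the sum is empty and the root on the right
    vanishes.\<close>
  next
    case False
    then have "m = 0" by simp
    then show ?thesis by simp
  qed
  ultimately show conv: "weak_conv_m (\<lambda>m. distr (N m) borel (?T m)) std_normal_distribution"
    by (simp only:)
  show "(\<lambda>m. measure (N m) {\<omega>\<in>space (N m). p \<in> ci95 m (simrum m (W m) A B \<omega>)})
      \<longlonglongrightarrow> measure std_normal_distribution {-1.96..1.96}"
  proof (rule weak_conv_m_sandwiched_event[OF conv real_dist_normal_dist measure_std_normal_singleton])
    show "prob_space (N m)" if "m \<ge> 1" for m
      using iid[OF that] by (simp add: iid_uniform_perms_def)
    show "?T m \<in> borel_measurable (N m)" if "m \<ge> 1" for m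
    proof -
      note [measurable] = minhash.measurable_simrum[OF row[OF that]]
      show ?thesis by measurable
    qed
    show "{\<omega>\<in>space (N m). p \<in> ci95 m (simrum m (W m) A B \<omega>)} \<in> sets (N m)" if "m \<ge> 1" for m
      by (rule minhash.ci95_event[OF row[OF that]])
    fix e :: real
    assume e: "0 < e" "e < 1.96"
    show "eventually (\<lambda>m. \<forall>\<omega>\<in>space (N m).
        (\<bar>?T m \<omega>\<bar> \<le> 1.96 - e \<longrightarrow> \<omega> \<in> {\<omega>\<in>space (N m). p \<in> ci95 m (simrum m (W m) A B \<omega>)}) \<and>
        (\<omega> \<in> {\<omega>\<in>space (N m). p \<in> ci95 m (simrum m (W m) A B \<omega>)} \<longrightarrow> \<bar>?T m \<omega>\<bar> < 1.96 + e)) sequentially"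
      using eventually_wald_interval_sandwich[OF p e] eventually_ge_at_top[of 1]
    proof eventually_elim
      case (elim m)
      have ci: "p \<in> ci95 m (simrum m (W m) A B \<omega>) \<longleftrightarrow> real m * (simrum m (W m) A B \<omega> - p)\<^sup>2
          \<le> 1.96\<^sup>2 * (simrum m (W m) A B \<omega> * (1 - simrum m (W m) A B \<omega>))" for \<omega>
        by (rule minhash.mem_ci95_simrum_iff[OF row[OF elim(2)]])
      \<comment> \<open>The sandwich is uniform over [0,1], so it may be specialised at the random
        point x = \<open>simrum m (W m) A B \<omega>\<close>.\<close>
      show ?case
        unfolding mem_Collect_eq ci
        using bspec[OF elim(1) minhash.simrum_bounds[OF row[OF elim(2)]]] by blast
    qed
  qed simp
qed

text \<open>The denominator n is correct when the two sets cover \<open>{1..n}\<close>; otherwise it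
  is the cardinality of their union. The asymptotic part has its own family of spaces because the
  sample size on \<open>M\<close> is fixed.\<close>

theorem mainTheorem2:
  fixes n k :: nat and A B :: "nat set"
    and M :: "'w measure" and Z :: "nat \<Rightarrow> 'w \<Rightarrow> nat \<Rightarrow> nat"
    and sim :: real
  assumes "A \<subseteq> {1..n}" and "B \<subseteq> {1..n}" and "A \<union> B \<noteq> {}"
    and "k \<ge> 1"
    and "iid_uniform_perms n k M Z"
    and "sim = similarity A B"
  shows
    "(\<forall>\<alpha>\<in>{1..k}. \<forall>\<omega>\<in>space M.
        min_over (Z \<alpha> \<omega>) A = min_over (Z \<alpha> \<omega>) B \<longleftrightarrow>
        min_over (Z \<alpha> \<omega>) (A \<inter> B) < min_over (Z \<alpha> \<omega>) ((A - B) \<union> (B - A))) \<and>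
     (\<forall>\<alpha>\<in>{1..k}.
        measure M {\<omega>\<in>space M. min_over (Z \<alpha> \<omega>) A = min_over (Z \<alpha> \<omega>) B} = sim) \<and>
     (A \<union> B = {1..n} \<longrightarrow>
        sim = real (card (A \<inter> B)) / real n \<and>
        (\<forall>\<alpha>\<in>{1..k}.
          measure M {\<omega>\<in>space M. min_over (Z \<alpha> \<omega>) A = min_over (Z \<alpha> \<omega>) B}
            = real (card (A \<inter> B)) / real n)) \<and>
     prob_space.indep_vars M (\<lambda>_. borel) (agree Z A B) {1..k} \<and>
     (\<forall>\<alpha>\<in>{1..k}. distr M borel (agree Z A B \<alpha>)
        = distr (measure_pmf (bernoulli_pmf sim)) borel of_bool) \<and>
     (\<forall>\<omega>\<in>space M. (\<Sum>\<alpha>=1..k. agree Z A B \<alpha> \<omega>) = real k * simrum k Z A B \<omega>) \<and>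
     prob_space.expectation M (simrum k Z A B) = sim \<and>
     prob_space.variance M (simrum k Z A B) = sim * (1 - sim) / real k \<and>
     (\<forall>l>0. measure M {\<omega>\<in>space M. \<bar>simrum k Z A B \<omega> - sim\<bar> > l}
        \<le> sim * (1 - sim) / (real k * l\<^sup>2)) \<and>
     (sim \<noteq> 0 \<and> sim \<noteq> 1 \<longrightarrow>
       (\<forall>(N :: nat \<Rightarrow> 'v measure) (W :: nat \<Rightarrow> nat \<Rightarrow> 'v \<Rightarrow> nat \<Rightarrow> nat).
         (\<forall>m\<ge>1. iid_uniform_perms n m (N m) (W m)) \<longrightarrow>
         weak_conv_m
           (\<lambda>m. distr (N m) borel
              (\<lambda>\<omega>. sqrt (real m / (sim * (1 - sim))) * (simrum m (W m) A B \<omega> - sim)))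
           std_normal_distribution \<and>
         (\<lambda>m. measure (N m) {\<omega>\<in>space (N m).
              sim \<in> ci95 m (simrum m (W m) A B \<omega>)})
           \<longlonglongrightarrow> measure std_normal_distribution {-1.96..1.96}) \<and>
       \<bar>measure std_normal_distribution {-1.96..1.96} - 0.95\<bar> < 1 / 10000)"
proof -
  interpret minhash n k A B M Z
    using assms by unfold_locales auto
  have sim: "sim = similarity A B" by fact
  have full: "sim = real (card (A \<inter> B)) / real n" if "A \<union> B = {1..n}"
    using that by (simp add: sim similarity_def)
  show ?thesis
  proof (intro conjI ballI allI impI)
    fix \<alpha> assume \<alpha>: "\<alpha> \<in> {1..k}"
    show "measure M {\<omega>\<in>space M. min_over (Z \<alpha> \<omega>) A = min_over (Z \<alpha> \<omega>) B} = sim"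
      using prob_min_over_eq[OF \<alpha>] sim by simp
    show "measure M {\<omega>\<in>space M. min_over (Z \<alpha> \<omega>) A = min_over (Z \<alpha> \<omega>) B}
        = real (card (A \<inter> B)) / real n" if "A \<union> B = {1..n}"
      using prob_min_over_eq[OF \<alpha>] sim full[OF that] by simp
    show "distr M borel (agree Z A B \<alpha>) = distr (measure_pmf (bernoulli_pmf sim)) borel of_bool"
      using distr_agree[OF \<alpha>] sim by simp
    show "min_over (Z \<alpha> \<omega>) A = min_over (Z \<alpha> \<omega>) B \<longleftrightarrow>
        min_over (Z \<alpha> \<omega>) (A \<inter> B) < min_over (Z \<alpha> \<omega>) ((A - B) \<union> (B - A))" if "\<omega> \<in> space M" for \<omega>
      by (rule min_over_eq_iff_Int_less[OF \<alpha> that])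
  next
    show "measure M {\<omega>\<in>space M. \<bar>simrum k Z A B \<omega> - sim\<bar> > l} \<le> sim * (1 - sim) / (real k * l\<^sup>2)"
      if "l > 0" for l
      using simrum_Chebyshev[OF that] sim by simp
  next
    fix N :: "nat \<Rightarrow> 'v measure" and W :: "nat \<Rightarrow> nat \<Rightarrow> 'v \<Rightarrow> nat \<Rightarrow> nat"
    assume nz: "sim \<noteq> 0 \<and> sim \<noteq> 1" and W: "\<forall>m\<ge>1. iid_uniform_perms n m (N m) (W m)"
    note CLT = simrum_asymptotically_normal[OF A B ne W[rule_format] sim[symmetric]
        conjunct1[OF nz] conjunct2[OF nz]]
    show "weak_conv_m (\<lambda>m. distr (N m) borel
        (\<lambda>\<omega>. sqrt (real m / (sim * (1 - sim))) * (simrum m (W m) A B \<omega> - sim))) std_normal_distribution"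
      by (rule CLT(1))
    show "(\<lambda>m. measure (N m) {\<omega>\<in>space (N m). sim \<in> ci95 m (simrum m (W m) A B \<omega>)})
        \<longlonglongrightarrow> measure std_normal_distribution {-1.96..1.96}"
      by (rule CLT(2))
  next
    show "expectation (simrum k Z A B) = sim"
      using expectation_simrum sim by simp
    show "variance (simrum k Z A B) = sim * (1 - sim) / real k"
      using variance_simrum sim by simp
  qed (rule full indep_agree sum_agree_eq measure_std_normal_196; assumption)+
qed

end
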